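(* Let $q=p^e$ be a prime power, $\ell$ an odd prime with $\ell\neq p$, and $n$ a positive integer divisible by neither $p$ nor $\ell$. Let $\gamma\in\mathbb{Z}$ and $\tau=|c_n(\gamma)|$. Assume that $\ell\mid q^\tau-1$, and put $v=v_\ell(q^\tau-1)$. Then: (1a) Every component of the sequence $\mathfrak{c}_\infty(\gamma)=\bigl(c_{\ell^i n}(\gamma+n\cdot\varphi(\gamma)_{\leq i-1})\bigr)_{i\in\mathbb{N}}$ has size $\tau$. (1b) For every $(m,a)\in\mathbb{N}\times[1,\ell-1]$ and $t\in[0,\ell^{v-1}-1]$, the sizes of the components of the sequence $\mathfrak{c}_{m,a,t}(\gamma)=\bigl(c_{\ell^i n}(\gamma+n(U(\gamma;m,a)+\ell^{m+1}t))\bigr)_{i\in\mathbb{N}}$ are $$|c_{\ell^i n}(\gamma+n(U(\gamma;m,a)+\ell^{m+1}t))|=\begin{cases}\tau, & 0\leq i\leq m+v,\\ \ell^{i-m-v}\cdot\tau, & i\geq m+v+1.\end{cases}$$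
   Context: Notation: $\mathbb{N}=\{0,1,2,\dots\}$; $[a,b]$ is the set of integers from $a$ to $b$; $v_\ell$ is the $\ell$-adic valuation. For $M\geq1$ coprime to $q$ and $\gamma\in\mathbb{Z}$, the $q$-cyclotomic coset modulo $M$ containing $\gamma$ is $c_M(\gamma)=\{\gamma,\gamma q,\dots,\gamma q^{\tau-1}\}\subseteq\mathbb{Z}/M\mathbb{Z}$, where $\tau$ is the least positive integer with $\gamma q^\tau\equiv\gamma\pmod M$; its size is $|c_M(\gamma)|=\tau$. $\varphi(\gamma)=-\gamma/n\in\mathbb{Z}_\ell$, with $\ell$-adic expansion $\varphi(\gamma)=\sum_{k\geq0}\phi_k\ell^k$, $\phi_k\in[0,\ell-1]$. For $i\geq0$, $\varphi(\gamma)_{\leq i}=\sum_{k=0}^i\phi_k\ell^k$, and $\varphi(\gamma)_{\leq-1}=0$. For $m\in\mathbb{N}$ write $[0,\ell-1]\setminus\{\phi_m\}=\{\sigma_1^m<\cdots<\sigma_{\ell-1}^m\}$, and for $a\in[1,\ell-1]$ put $U(\gamma;m,a)=\sum_{k=0}^{m-1}\phi_k\ell^k+\sigma_a^m\ell^m$. *)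

theory Defs
  imports "HOL-Number_Theory.Number_Theory" "HOL-Algebra.Ring"
begin

section \<open>Cyclotomic cosets\<close>

text \<open>
  Elements of \<open>\<int>/M\<int>\<close> are represented by their residues in \<open>{0..<M}\<close>, so that a subset
  of \<open>\<int>/M\<int>\<close> is a set of integers and its size is \<^const>\<open>card\<close>.
\<close>

definition coset_period :: "nat \<Rightarrow> nat \<Rightarrow> int \<Rightarrow> nat" where
  "coset_period q M \<gamma> = (LEAST t. 0 < t \<and> [\<gamma> * int q ^ t = \<gamma>] (mod int M))"

definition cyc_coset :: "nat \<Rightarrow> nat \<Rightarrow> int \<Rightarrow> int set" where
  "cyc_coset q M \<gamma> = (\<lambda>j. (\<gamma> * int q ^ j) mod int M) ` {..<coset_period q M \<gamma>}"


section \<open>The ring of l-adic integers\<close>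

text \<open>
  The inverse limit of the rings \<open>\<int>/l^i\<int>\<close>: an element is a sequence whose \<open>i\<close>-th entry
  is a residue modulo \<open>l^i\<close>, compatible with the reduction maps.
\<close>

definition padic_ring :: "nat \<Rightarrow> (nat \<Rightarrow> int) ring" where
  "padic_ring l =
     \<lparr>carrier = {x. \<forall>i. x i \<in> {0..<int l ^ i} \<and> x (Suc i) mod int l ^ i = x i},
      monoid.mult = (\<lambda>x y i. (x i * y i) mod int l ^ i),
      one = (\<lambda>i. 1 mod int l ^ i),
      zero = (\<lambda>i. 0),
      add = (\<lambda>x y i. (x i + y i) mod int l ^ i)\<rparr>"

definition padic_of_int :: "nat \<Rightarrow> int \<Rightarrow> nat \<Rightarrow> int" where
  "padic_of_int l z = (\<lambda>i. z mod int l ^ i)"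

text \<open>
  The \<open>k\<close>-th coefficient of the l-adic expansion; that these coefficients give the
  expansion, and are the only ones to do so, is shown in \<open>padic_expansion\<close> and
  \<open>padic_expansion_unique\<close> below.
\<close>

definition padic_digit :: "nat \<Rightarrow> (nat \<Rightarrow> int) \<Rightarrow> nat \<Rightarrow> int" where
  "padic_digit l x k = x (Suc k) div int l ^ k"

lemma padic_of_int_carrier: "0 < l \<Longrightarrow> padic_of_int l z \<in> carrier (padic_ring l)"
  by (auto simp: padic_of_int_def padic_ring_def mod_mod_cancel)

lemma padic_cring:
  assumes "0 < l"
  shows "cring (padic_ring l)"
proof -
  have pos: "0 < int l ^ i" for i using assms by simp
  have red: "(a mod int l ^ Suc i) mod int l ^ i = a mod int l ^ i" for a i
    by (simp add: mod_mod_cancel)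
  have cr: "x \<in> carrier (padic_ring l) \<longleftrightarrow>
      (\<forall>i. 0 \<le> x i \<and> x i < int l ^ i \<and> x (Suc i) mod int l ^ i = x i)" for x
    by (auto simp: padic_ring_def)
  have mod_id: "x i mod int l ^ i = x i" if "x \<in> carrier (padic_ring l)" for x i
    using that by (simp add: cr)
  have uminus: "(\<lambda>i. (- x i) mod int l ^ i) \<in> carrier (padic_ring l)"
    if "x \<in> carrier (padic_ring l)" for x
    using that pos red by (simp add: cr) (metis mod_minus_eq)
  have add: "(\<lambda>i. (x i + y i) mod int l ^ i) \<in> carrier (padic_ring l)"
    if "x \<in> carrier (padic_ring l)" "y \<in> carrier (padic_ring l)" for x y
    using that pos by (simp add: cr mod_mod_cancel) (metis mod_add_eq)
  have mult: "(\<lambda>i. (x i * y i) mod int l ^ i) \<in> carrier (padic_ring l)"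
    if "x \<in> carrier (padic_ring l)" "y \<in> carrier (padic_ring l)" for x y
    using that pos by (simp add: cr mod_mod_cancel) (metis mod_mult_eq)
  have one: "(\<lambda>i. 1 mod int l ^ i) \<in> carrier (padic_ring l)"
    using padic_of_int_carrier[OF assms, of 1] by (simp add: padic_of_int_def)
  have zero: "(\<lambda>i. 0) \<in> carrier (padic_ring l)"
    using padic_of_int_carrier[OF assms, of 0] by (simp add: padic_of_int_def)
  have fields: "x \<otimes>\<^bsub>padic_ring l\<^esub> y = (\<lambda>i. (x i * y i) mod int l ^ i)"
    "x \<oplus>\<^bsub>padic_ring l\<^esub> y = (\<lambda>i. (x i + y i) mod int l ^ i)"
    "\<one>\<^bsub>padic_ring l\<^esub> = (\<lambda>i. 1 mod int l ^ i)" "\<zero>\<^bsub>padic_ring l\<^esub> = (\<lambda>i. 0)" for x y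
    by (auto simp: padic_ring_def)
  show ?thesis
  proof (rule cringI)
    show "abelian_group (padic_ring l)"
    proof (rule abelian_groupI)
      fix x assume x: "x \<in> carrier (padic_ring l)"
      show "\<exists>y\<in>carrier (padic_ring l). y \<oplus>\<^bsub>padic_ring l\<^esub> x = \<zero>\<^bsub>padic_ring l\<^esub>"
        by (rule bexI[OF _ uminus[OF x]]) (simp add: fields mod_simps)
    qed (auto simp: fields add zero mod_id mod_simps algebra_simps)
    show "Group.comm_monoid (padic_ring l)"
      by (rule Group.comm_monoidI) (auto simp: fields mult one mod_id mod_simps algebra_simps)
  qed (auto simp: fields mod_simps algebra_simps)
qed

lemma padic_of_int_Units:
  assumes "0 < l" "coprime n (int l)"
  shows "padic_of_int l n \<in> Units (padic_ring l)"
proof -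
  have "\<exists>b. [n * b = 1] (mod int l ^ i)" for i
    using assms by (intro cong_solve_coprime_int) simp
  then obtain b where b: "[n * b i = 1] (mod int l ^ i)" for i by metis
  have "[n * b (Suc i) = n * b i] (mod int l ^ i)" for i
  proof -
    have "[n * b (Suc i) = 1] (mod int l ^ i)"
      using b[of "Suc i"] by (rule cong_dvd_modulus) simp
    then show ?thesis using b[of i] by (metis cong_sym cong_trans)
  qed
  then have "[b (Suc i) = b i] (mod int l ^ i)" for i
    using assms by (simp add: cong_mult_lcancel)
  then have "(\<lambda>i. b i mod int l ^ i) \<in> carrier (padic_ring l)"
    using assms by (auto simp: padic_ring_def mod_mod_cancel cong_def)
  moreover have "(\<lambda>i. b i mod int l ^ i) \<otimes>\<^bsub>padic_ring l\<^esub> padic_of_int l n = \<one>\<^bsub>padic_ring l\<^esub>"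
    "padic_of_int l n \<otimes>\<^bsub>padic_ring l\<^esub> (\<lambda>i. b i mod int l ^ i) = \<one>\<^bsub>padic_ring l\<^esub>"
    using b by (auto simp: padic_ring_def padic_of_int_def mod_simps cong_def mult.commute)
  ultimately show ?thesis
    using padic_of_int_carrier[OF assms(1)] unfolding Units_def by blast
qed

lemma padic_digit_range:
  assumes "x \<in> carrier (padic_ring l)"
  shows "padic_digit l x k \<in> {0..<int l}"
proof -
  have "\<forall>i. 0 \<le> x i \<and> x i < int l ^ i"
    using assms by (simp add: padic_ring_def)
  then have *: "0 \<le> x (Suc k)" "x (Suc k) < int l * int l ^ k"
    by (blast, simp flip: power_Suc)
  then have "0 < l" by (cases "l = 0") auto
  then have "0 < int l ^ k" by simp
  have "x (Suc k) div int l ^ k < int l"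
  proof (rule ccontr)
    assume "\<not> x (Suc k) div int l ^ k < int l"
    then have "int l * int l ^ k \<le> x (Suc k) div int l ^ k * int l ^ k"
      using \<open>0 < int l ^ k\<close> by (intro mult_right_mono) auto
    also have "\<dots> = x (Suc k) - x (Suc k) mod int l ^ k"
      by (rule minus_mod_eq_div_mult [symmetric])
    also have "\<dots> \<le> x (Suc k)" using \<open>0 < int l ^ k\<close> by simp
    finally show False using * by simp
  qed
  then show ?thesis
    using * \<open>0 < int l ^ k\<close> by (simp add: padic_digit_def pos_imp_zdiv_nonneg_iff)
qed

lemma padic_expansion:
  assumes "x \<in> carrier (padic_ring l)"
  shows "x i = (\<Sum>k<i. padic_digit l x k * int l ^ k)"
proof (induction i)
  case 0
  have "\<forall>i. 0 \<le> x i \<and> x i < int l ^ i"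
    using assms by (simp add: padic_ring_def)
  from spec[OF this, of 0] show ?case by simp
next
  case (Suc i)
  have "x (Suc i) = x (Suc i) div int l ^ i * int l ^ i + x (Suc i) mod int l ^ i"
    by (rule div_mult_mod_eq [symmetric])
  also have "x (Suc i) mod int l ^ i = x i"
    using assms by (simp add: padic_ring_def)
  finally show ?case using Suc by (simp add: padic_digit_def)
qed

lemma padic_expansion_unique:
  assumes "\<And>k. d k \<in> {0..<int l}"
    and "\<And>i. x i = (\<Sum>k<i. d k * int l ^ k) mod int l ^ i"
  shows "padic_digit l x k = d k"
proof -
  have l: "0 < int l" using assms(1)[of 0] by auto
  have *: "(\<Sum>k<i. d k * int l ^ k) \<in> {0..<int l ^ i}" for i
  proof (induction i)
    case (Suc i)
    have "d i * int l ^ i \<le> (int l - 1) * int l ^ i"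
      using assms(1)[of i] l by (intro mult_right_mono) auto
    then show ?case using Suc assms(1)[of i] by (auto simp: algebra_simps)
  qed simp
  have "x (Suc k) = (\<Sum>j<k. d j * int l ^ j) + d k * int l ^ k"
    using assms(2)[of "Suc k"] *[of "Suc k"] by simp
  then show ?thesis
    using *[of k] l by (simp add: padic_digit_def)
qed


section \<open>The branches attached to an integer\<close>

text \<open>\<open>\<phi>(\<gamma>) = -\<gamma>/n\<close>, where \<open>n\<close> is a unit by \<open>padic_of_int_Units\<close> when \<open>l\<close> is coprime to it.\<close>

definition phi :: "nat \<Rightarrow> nat \<Rightarrow> int \<Rightarrow> nat \<Rightarrow> int" where
  "phi l n \<gamma> = (\<ominus>\<^bsub>padic_ring l\<^esub> padic_of_int l \<gamma>)
     \<otimes>\<^bsub>padic_ring l\<^esub> inv\<^bsub>padic_ring l\<^esub> (padic_of_int l (int n))"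

abbreviation phi_digit :: "nat \<Rightarrow> nat \<Rightarrow> int \<Rightarrow> nat \<Rightarrow> int" where
  "phi_digit l n \<gamma> k \<equiv> padic_digit l (phi l n \<gamma>) k"

text \<open>
  The truncation of \<open>\<phi>(\<gamma>)\<close> after the digit of index \<open>i - 1\<close> (not \<open>i\<close>), written
  \<open>\<phi>(\<gamma>)\<^sub>\<le>\<^sub>i\<^sub>-\<^sub>1\<close>; it is \<open>0\<close> for \<open>i = 0\<close>.
\<close>

definition phi_trunc :: "nat \<Rightarrow> nat \<Rightarrow> int \<Rightarrow> nat \<Rightarrow> int" where
  "phi_trunc l n \<gamma> i = (\<Sum>k<i. phi_digit l n \<gamma> k * int l ^ k)"

text \<open>The list is indexed from \<open>0\<close>, whereas \<open>a\<close> ranges over \<open>{1..l - 1}\<close>.\<close>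

definition sigma :: "nat \<Rightarrow> nat \<Rightarrow> int \<Rightarrow> nat \<Rightarrow> nat \<Rightarrow> int" where
  "sigma l n \<gamma> m a = sorted_list_of_set ({0..int l - 1} - {phi_digit l n \<gamma> m}) ! (a - 1)"

definition U :: "nat \<Rightarrow> nat \<Rightarrow> int \<Rightarrow> nat \<Rightarrow> nat \<Rightarrow> int" where
  "U l n \<gamma> m a = (\<Sum>k<m. phi_digit l n \<gamma> k * int l ^ k) + sigma l n \<gamma> m a * int l ^ m"

definition coset_seq_inf :: "nat \<Rightarrow> nat \<Rightarrow> nat \<Rightarrow> int \<Rightarrow> nat \<Rightarrow> int set" where
  "coset_seq_inf q l n \<gamma> i = cyc_coset q (l ^ i * n) (\<gamma> + int n * phi_trunc l n \<gamma> i)"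

definition coset_seq ::
    "nat \<Rightarrow> nat \<Rightarrow> nat \<Rightarrow> nat \<Rightarrow> nat \<Rightarrow> nat \<Rightarrow> int \<Rightarrow> nat \<Rightarrow> int set" where
  "coset_seq q l n m a t \<gamma> i =
     cyc_coset q (l ^ i * n) (\<gamma> + int n * (U l n \<gamma> m a + int l ^ (m + 1) * int t))"

end

theory Submission
  imports Defs
begin

text \<open>
  A coset modulo \<open>l^i n\<close> of some \<open>\<delta> \<equiv> \<gamma>\<close> modulo \<open>n\<close> has for its size the least \<open>t > 0\<close> with
  \<open>\<tau> dvd t\<close> and \<open>l^i dvd \<delta> (q^t - 1)\<close>. By lifting the exponent, \<open>q^(\<tau> s) - 1\<close> has valuation
  \<open>v + v_l(s)\<close>, so everything depends on the valuation of \<open>\<delta> = \<gamma> + n x\<close>: it is at least \<open>i\<close>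
  when \<open>x\<close> is the \<open>i\<close>-th truncation of \<open>-\<gamma>/n\<close>, and exactly \<open>m\<close> when \<open>x\<close> first departs from
  \<open>-\<gamma>/n\<close> in the digit of index \<open>m\<close>.
\<close>

section \<open>Lifting the exponent\<close>

text \<open>Modulo \<open>l\<close> every power of \<open>a\<close> is 1, so the cofactor of
  \<open>a - 1\<close> in \<open>a ^ s - 1\<close> is congruent to \<open>s\<close> and contributes
  no factor \<open>l\<close>.\<close>

lemma multiplicity_power_minus_one_coprime:
  fixes a :: int and l s :: nat
  assumes l: "prime l" and a: "int l dvd a - 1" "a \<noteq> 1" and s: "\<not> l dvd s"
  shows "multiplicity (int l) (a ^ s - 1) = multiplicity (int l) (a - 1)"
proof -
  have "[a = 1] (mod int l)"
    using a(1) by (simp add: cong_iff_dvd_diff)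
  then have "[(\<Sum>j<s. a ^ j) = (\<Sum>j<s. 1 ^ j)] (mod int l)"
    by (intro cong_sum cong_pow)
  then have *: "\<not> int l dvd (\<Sum>j<s. a ^ j)"
    using s by (simp add: cong_dvd_iff)
  then have "multiplicity (int l) (\<Sum>j<s. a ^ j) = 0"
    by (rule not_dvd_imp_multiplicity_0)
  moreover have "(\<Sum>j<s. a ^ j) \<noteq> 0"
    using * by auto
  moreover have "a ^ s - 1 = (a - 1) * (\<Sum>j<s. a ^ j)"
    by (rule power_diff_1_eq)
  ultimately show ?thesis
    using l a(2) by (simp add: prime_elem_multiplicity_mult_distrib)
qed

text \<open>The cofactor of \<open>a - 1\<close> in \<open>a ^ l - 1\<close> is congruent to
  \<open>l\<close> modulo \<open>l ^ 2\<close>, so it contributes exactly one factor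
  \<open>l\<close>.\<close>

lemma multiplicity_power_minus_one_prime:
  fixes a :: int and l :: nat
  assumes l: "prime l" "odd l" and a: "int l dvd a - 1" "a \<noteq> 1"
  shows "multiplicity (int l) (a ^ l - 1) = Suc (multiplicity (int l) (a - 1))"
proof -
  obtain c where c: "a = 1 + int l * c"
    using a(1) by (metis add.commute diff_add_cancel dvdE)
  \<comment> \<open>The binomial expansion of \<open>(1 + l * c) ^ j\<close>, cut off after the
    linear term.\<close>
  have pow: "[a ^ j = 1 + int j * (int l * c)] (mod int l ^ 2)" for j
  proof (induction j)
    case (Suc j)
    have "[a ^ Suc j = a * (1 + int j * (int l * c))] (mod int l ^ 2)"
      using cong_scalar_left[OF Suc, of a] by simp
    moreover have "a * (1 + int j * (int l * c))
        = 1 + int (Suc j) * (int l * c) + int l ^ 2 * (int j * c ^ 2)"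
      by (simp add: c algebra_simps power2_eq_square)
    ultimately show ?case
      by (simp add: cong_def)
  qed simp
  \<comment> \<open>Oddness makes \<open>l (l - 1) / 2\<close> a multiple of \<open>l\<close>, so
    the linear terms sum to 0 modulo \<open>l ^ 2\<close>.\<close>
  obtain h where h: "l = Suc (2 * h)"
    using l(2) by (metis oddE Suc_eq_plus1)
  have "(\<Sum>j<Suc (2 * h). int j) = int (Suc (2 * h)) * int h"
    by (induction h) (auto simp: algebra_simps)
  then have half: "(\<Sum>j<l. int j) = int l * int h"
    using h by simp
  have "[(\<Sum>j<l. a ^ j) = (\<Sum>j<l. 1 + int j * (int l * c))] (mod int l ^ 2)"
    by (intro cong_sum pow)
  also have "(\<Sum>j<l. 1 + int j * (int l * c)) = int l + (\<Sum>j<l. int j) * (int l * c)"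
    by (simp add: sum.distrib sum_distrib_right)
  also have "\<dots> = int l + int l ^ 2 * (int h * c)"
    by (simp add: half power2_eq_square algebra_simps)
  finally have S: "[(\<Sum>j<l. a ^ j) = int l] (mod int l ^ 2)"
    by (simp add: cong_def)
  have "\<not> int l ^ 2 dvd int l"
    using l(1) by (metis One_nat_def Suc_1 dvd_refl int_dvd_int_iff not_prime_unit of_nat_power
        power2_eq_square prime_gt_0_nat dvd_mult_cancel1)
  then have n2: "\<not> int l ^ 2 dvd (\<Sum>j<l. a ^ j)"
    using S by (simp add: cong_dvd_iff)
  have "[(\<Sum>j<l. a ^ j) = int l] (mod int l)"
    using S by (rule cong_dvd_modulus) (simp add: power2_eq_square)
  then have "int l dvd (\<Sum>j<l. a ^ j)"
    by (simp add: cong_dvd_iff)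
  with n2 have "multiplicity (int l) (\<Sum>j<l. a ^ j) = 1"
    by (intro multiplicity_eqI) (simp_all add: numeral_2_eq_2)
  moreover have "(\<Sum>j<l. a ^ j) \<noteq> 0"
    using n2 by auto
  moreover have "a ^ l - 1 = (a - 1) * (\<Sum>j<l. a ^ j)"
    by (rule power_diff_1_eq)
  ultimately show ?thesis
    using l(1) a(2) by (simp add: prime_elem_multiplicity_mult_distrib)
qed

text \<open>Split off the \<open>l\<close>-part of \<open>s\<close>: the cofactor \<open>r\<close>
  prime to \<open>l\<close> changes nothing, and each further \<open>l\<close>-th power adds one.
  Since \<open>a > 1\<close>, no power with positive exponent equals 1.\<close>

lemma multiplicity_power_minus_one:
  fixes a :: int and l s :: nat
  assumes l: "prime l" "odd l" and a: "int l dvd a - 1" "a > 1" and s: "s > 0"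
  shows "multiplicity (int l) (a ^ s - 1) = multiplicity (int l) (a - 1) + multiplicity l s"
proof -
  obtain r where r: "s = l ^ multiplicity l s * r" "\<not> l dvd r"
    using l(1) s multiplicity_decompose'[of s l] by (metis not_gr0 not_prime_unit)
  have "multiplicity (int l) (a ^ (l ^ k * r) - 1) = multiplicity (int l) (a - 1) + k" for k
  proof (induction k)
    case 0
    then show ?case
      using multiplicity_power_minus_one_coprime[OF l(1) a(1) _ r(2)] a(2) by simp
  next
    case (Suc k)
    have "int l dvd a ^ (l ^ k * r) - 1"
      using a(1) by (metis dvd_mult2 power_diff_1_eq)
    moreover have "l ^ k * r > 0"
      using l(1) r s by (metis not_gr0 mult_0_right prime_gt_0_nat zero_less_power nat_0_less_mult_iff)
    then have "a ^ (l ^ k * r) > 1"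
      using a(2) by (intro one_less_power)
    ultimately have "multiplicity (int l) ((a ^ (l ^ k * r)) ^ l - 1)
        = Suc (multiplicity (int l) (a ^ (l ^ k * r) - 1))"
      by (intro multiplicity_power_minus_one_prime l) auto
    moreover have "(a ^ (l ^ k * r)) ^ l = a ^ (l ^ Suc k * r)"
      by (simp add: power_mult [symmetric] mult_ac)
    ultimately show ?case
      using Suc by simp
  qed
  then show ?thesis
    using r(1) by metis
qed


section \<open>Sizes of cyclotomic cosets\<close>

text \<open>Euler's theorem supplies a witness for the \<open>LEAST\<close> in the
  definition.\<close>

lemma coset_period:
  assumes "coprime q M" "M > 0"
  shows "coset_period q M \<gamma> > 0" "[\<gamma> * int q ^ coset_period q M \<gamma> = \<gamma>] (mod int M)"
proof -
  have "[int q ^ totient M = 1] (mod int M)"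
    using euler_theorem[OF assms(1)] by (metis cong_int_iff of_nat_1 of_nat_power)
  then have "[\<gamma> * int q ^ totient M = \<gamma>] (mod int M)"
    using cong_scalar_left[of _ 1 _ \<gamma>] by simp
  then have "\<exists>t. 0 < t \<and> [\<gamma> * int q ^ t = \<gamma>] (mod int M)"
    using assms(2) by (intro exI[of _ "totient M"]) simp
  from LeastI_ex[OF this]
  show "coset_period q M \<gamma> > 0" "[\<gamma> * int q ^ coset_period q M \<gamma> = \<gamma>] (mod int M)"
    unfolding coset_period_def by auto
qed

lemma coset_period_dvd_iff:
  assumes "coprime q M" "M > 0"
  shows "coset_period q M \<gamma> dvd t \<longleftrightarrow> [\<gamma> * int q ^ t = \<gamma>] (mod int M)"
proof -
  define P where "P = coset_period q M \<gamma>"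
  have P: "P > 0" "[\<gamma> * int q ^ P = \<gamma>] (mod int M)"
    using coset_period[OF assms] by (simp_all add: P_def)
  have mul: "[\<gamma> * int q ^ (P * k) = \<gamma>] (mod int M)" for k
  proof (induction k)
    case (Suc k)
    have "[\<gamma> * int q ^ (P * k) * int q ^ P = \<gamma> * int q ^ P] (mod int M)"
      by (intro cong_scalar_right Suc)
    with P(2) show ?case
      by (metis cong_trans mult.assoc mult_Suc_right power_add add.commute)
  qed simp
  \<comment> \<open>Division with remainder: only \<open>t mod P\<close> matters, and minimality of
    \<open>P\<close> forces it to vanish.\<close>
  have "[\<gamma> * int q ^ t = \<gamma> * int q ^ (t mod P)] (mod int M)"
    using cong_scalar_right[OF mul[of "t div P"], of "int q ^ (t mod P)"]
    by (simp add: mult.assoc flip: power_add)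
  then have "[\<gamma> * int q ^ t = \<gamma>] (mod int M) \<longleftrightarrow> [\<gamma> * int q ^ (t mod P) = \<gamma>] (mod int M)"
    by (simp add: cong_def)
  also have "\<dots> \<longleftrightarrow> t mod P = 0"
  proof
    assume "[\<gamma> * int q ^ (t mod P) = \<gamma>] (mod int M)"
    moreover have "t mod P < P"
      using P(1) by simp
    ultimately show "t mod P = 0"
      using not_less_Least[of "t mod P" "\<lambda>t. 0 < t \<and> [\<gamma> * int q ^ t = \<gamma>] (mod int M)"]
      by (auto simp: P_def coset_period_def)
  qed simp
  finally show ?thesis
    by (simp add: P_def mod_eq_0_iff_dvd)
qed

text \<open>As \<open>q\<close> is invertible modulo \<open>M\<close>, a repetition at
  \<open>i < j\<close> cancels to a return to \<gamma> after \<open>j - i\<close> steps, fewer than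
  the period.\<close>

lemma card_cyc_coset:
  assumes "coprime q M" "M > 0"
  shows "card (cyc_coset q M \<gamma>) = coset_period q M \<gamma>"
proof -
  have less: "i = j" if ij: "i \<le> j" "j < coset_period q M \<gamma>"
    and eq: "(\<gamma> * int q ^ i) mod int M = (\<gamma> * int q ^ j) mod int M" for i j
  proof -
    have "int q ^ j = int q ^ (j - i) * int q ^ i"
      using ij(1) by (simp flip: power_add)
    with eq have "[\<gamma> * int q ^ (j - i) * int q ^ i = \<gamma> * int q ^ i] (mod int M)"
      by (simp add: cong_def mult.assoc)
    moreover have "coprime (int q ^ i) (int M)"
      using assms(1) by simp
    ultimately have "[\<gamma> * int q ^ (j - i) = \<gamma>] (mod int M)"
      by (simp add: cong_mult_rcancel)
    then have "coset_period q M \<gamma> dvd j - i"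
      by (simp add: coset_period_dvd_iff assms)
    then show ?thesis
      using ij nat_dvd_not_less[of "j - i" "coset_period q M \<gamma>"] by fastforce
  qed
  have "inj_on (\<lambda>j. (\<gamma> * int q ^ j) mod int M) {..<coset_period q M \<gamma>}"
    by (rule inj_onI) (metis less lessThan_iff nat_le_linear)
  then show ?thesis
    by (simp add: cyc_coset_def card_image)
qed

text \<open>A natural number is determined by its multiples, so a size can be found without handling
  minimality.\<close>

lemma card_cyc_coset_eqI:
  assumes "coprime q M" "M > 0"
    and "\<And>t. [\<gamma> * int q ^ t = \<gamma>] (mod int M) \<longleftrightarrow> s dvd t"
  shows "card (cyc_coset q M \<gamma>) = s"
  using assms by (metis card_cyc_coset coset_period_dvd_iff dvd_antisym dvd_refl)

text \<open>The Chinese remainder theorem separates the condition modulo \<open>n\<close>, where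
  \<delta> may be replaced by \<gamma>, from the one modulo \<open>l ^ i\<close>.\<close>

lemma cong_cyclotomic_lift_iff:
  fixes \<gamma> \<delta> :: int
  assumes "coprime q n" "coprime l n" "n > 0" "[\<delta> = \<gamma>] (mod int n)"
  shows "[\<delta> * int q ^ t = \<delta>] (mod int (l ^ i * n)) \<longleftrightarrow>
    card (cyc_coset q n \<gamma>) dvd t \<and> int l ^ i dvd \<delta> * (int q ^ t - 1)"
proof -
  have "coprime (int l ^ i) (int n)"
    using assms(2) by simp
  then have "int l ^ i * int n dvd x \<longleftrightarrow> int l ^ i dvd x \<and> int n dvd x" for x
    by (auto intro: divides_mult dest: dvd_mult_left dvd_mult_right)
  then have "[\<delta> * int q ^ t = \<delta>] (mod int (l ^ i * n)) \<longleftrightarrow>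
      int l ^ i dvd \<delta> * (int q ^ t - 1) \<and> [\<delta> * int q ^ t = \<delta>] (mod int n)"
    by (simp add: cong_iff_dvd_diff right_diff_distrib)
  also have "[\<delta> * int q ^ t = \<delta>] (mod int n) \<longleftrightarrow> [\<gamma> * int q ^ t = \<gamma>] (mod int n)"
    using assms(4) by (meson cong_scalar_right cong_sym cong_trans)
  also have "\<dots> \<longleftrightarrow> card (cyc_coset q n \<gamma>) dvd t"
    using assms by (simp add: card_cyc_coset coset_period_dvd_iff)
  finally show ?thesis
    by blast
qed

text \<open>Here the condition modulo \<open>l ^ i\<close> is automatic. Using divisibility instead
  of a valuation covers \<delta> = 0, which occurs for \<gamma> = 0.\<close>

lemma card_cyc_coset_lift_dvd:
  fixes \<gamma> \<delta> :: int
  assumes "coprime q n" "coprime l n" "coprime q l" "n > 0" "l > 0" "[\<delta> = \<gamma>] (mod int n)"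
    and "int l ^ i dvd \<delta>"
  shows "card (cyc_coset q (l ^ i * n) \<delta>) = card (cyc_coset q n \<gamma>)"
proof (rule card_cyc_coset_eqI)
  show "[\<delta> * int q ^ t = \<delta>] (mod int (l ^ i * n)) \<longleftrightarrow> card (cyc_coset q n \<gamma>) dvd t" for t
    using cong_cyclotomic_lift_iff[OF assms(1,2,4,6), of t i] assms(7) by simp
qed (use assms in auto)

text \<open>For \<open>t = \<tau> * s\<close> the condition modulo \<open>l ^ i\<close> bounds the
  valuation of \<open>s\<close> from below, by lifting the exponent. Truncated subtraction makes
  this bound 0 while \<open>i\<close> is small.\<close>

lemma card_cyc_coset_lift_multiplicity:
  fixes q l n :: nat and \<gamma> \<delta> :: int
  defines "\<tau> \<equiv> card (cyc_coset q n \<gamma>)"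
  assumes q: "coprime q n" "coprime q l" "q > 1" and l: "prime l" "odd l" "coprime l n"
    and n: "n > 0" and \<delta>: "[\<delta> = \<gamma>] (mod int n)" "\<delta> \<noteq> 0"
    and dvd: "int l dvd int q ^ \<tau> - 1"
  shows "card (cyc_coset q (l ^ i * n) \<delta>)
    = l ^ (i - multiplicity (int l) \<delta> - multiplicity (int l) (int q ^ \<tau> - 1)) * \<tau>"
    (is "_ = l ^ ?k * \<tau>")
proof (rule card_cyc_coset_eqI)
  have \<tau>: "\<tau> > 0"
    using coset_period(1) card_cyc_coset q(1) n by (simp add: \<tau>_def)
  have large: "int q ^ s > 1" if "s > 0" for s
    using q(3) that by (intro one_less_power) auto
  have lte: "int l ^ i dvd \<delta> * (int q ^ (\<tau> * s) - 1) \<longleftrightarrow> l ^ ?k dvd s" for s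
  \<comment> \<open>For \<open>s = 0\<close> both sides hold; this case is apart because
    \<open>multiplicity\<close> is 0 at 0.\<close>
  proof (cases "s = 0")
    case False
    then have "int q ^ (\<tau> * s) - 1 \<noteq> 0"
      using large[of "\<tau> * s"] \<tau> by simp
    moreover from this have "\<delta> * (int q ^ (\<tau> * s) - 1) \<noteq> 0"
      using \<delta>(2) by simp
    moreover have "\<not> is_unit (int l)" "\<not> is_unit l" "prime_elem (int l)"
      using l(1) by (auto simp: prime_gt_1_nat)
    moreover have "multiplicity (int l) (int q ^ (\<tau> * s) - 1)
        = multiplicity (int l) (int q ^ \<tau> - 1) + multiplicity l s"
      using multiplicity_power_minus_one[OF l(1,2) dvd large[OF \<tau>], of s] False
      by (simp add: power_mult)
    ultimately show ?thesis
      using \<delta>(2) False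
      by (auto simp: power_dvd_iff_le_multiplicity prime_elem_multiplicity_mult_distrib)
  qed simp
  have "\<tau> dvd t \<and> int l ^ i dvd \<delta> * (int q ^ t - 1) \<longleftrightarrow> l ^ ?k * \<tau> dvd t" for t
  proof (cases "\<tau> dvd t")
    case True
    then obtain s where s: "t = \<tau> * s" ..
    then show ?thesis
      using lte[of s] \<tau>
      by (simp add: mult.commute[of "l ^ ?k"])
  next
    case False
    then show ?thesis
      using dvd_mult_right by blast
  qed
  then show "[\<delta> * int q ^ t = \<delta>] (mod int (l ^ i * n)) \<longleftrightarrow> l ^ ?k * \<tau> dvd t" for t
    using cong_cyclotomic_lift_iff[OF q(1) l(3) n \<delta>(1), of t i] by (simp add: \<tau>_def)
qed (use q l n in \<open>auto simp: prime_gt_0_nat\<close>)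


section \<open>The expansion of \<open>-\<gamma>/n\<close>\<close>

lemma phi_carrier:
  assumes "l > 0" "coprime (int n) (int l)"
  shows "phi l n \<gamma> \<in> carrier (padic_ring l)"
proof -
  interpret cring "padic_ring l" by (rule padic_cring[OF assms(1)])
  show ?thesis
    using padic_of_int_Units[OF assms] padic_of_int_carrier[OF assms(1)]
    by (simp add: phi_def)
qed

text \<open>The relation \<gamma> + n \<phi>(\<gamma>) = 0 in the ring, read in its
  \<open>i\<close>-th entry; that entry of \<phi>(\<gamma>) is the sum of the first \<open>i\<close>
  terms of its expansion.\<close>

lemma dvd_add_phi_trunc:
  assumes "l > 0" "coprime (int n) (int l)"
  shows "int l ^ i dvd \<gamma> + int n * phi_trunc l n \<gamma> i"
proof -
  interpret cring "padic_ring l" by (rule padic_cring[OF assms(1)])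
  let ?R = "padic_ring l"
  have c: "padic_of_int l z \<in> carrier ?R" for z
    by (rule padic_of_int_carrier[OF assms(1)])
  have "phi l n \<gamma> \<otimes>\<^bsub>?R\<^esub> padic_of_int l (int n) = \<ominus>\<^bsub>?R\<^esub> padic_of_int l \<gamma>"
    using padic_of_int_Units[OF assms] c by (simp add: phi_def m_assoc)
  then have "padic_of_int l \<gamma> \<oplus>\<^bsub>?R\<^esub> (phi l n \<gamma> \<otimes>\<^bsub>?R\<^esub> padic_of_int l (int n)) = \<zero>\<^bsub>?R\<^esub>"
    using c by (simp add: r_neg)
  then have "(\<gamma> mod int l ^ i + phi l n \<gamma> i * (int n mod int l ^ i) mod int l ^ i) mod int l ^ i = 0"
    by (auto simp: padic_ring_def padic_of_int_def dest: fun_cong[of _ _ i])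
  then have "int l ^ i dvd \<gamma> + int n * phi l n \<gamma> i"
    by (simp add: mod_simps mult.commute dvd_eq_mod_eq_0)
  then show ?thesis
    using padic_expansion[OF phi_carrier[OF assms], of \<gamma> i] by (simp add: phi_trunc_def)
qed

text \<open>The removed digit does lie in the range, so \<open>l - 1\<close> digits remain and the
  index \<open>a - 1\<close> is within bounds.\<close>

lemma sigma_mem:
  assumes "l > 0" "coprime (int n) (int l)" "a \<in> {1..l - 1}"
  shows "sigma l n \<gamma> m a \<in> {0..int l - 1} - {phi_digit l n \<gamma> m}" (is "_ \<in> ?S")
proof -
  have "phi_digit l n \<gamma> m \<in> {0..int l - 1}"
    using padic_digit_range[OF phi_carrier[OF assms(1,2)], of \<gamma> m] by simp
  then have "card ?S = l - 1"
    by (simp add: card_Diff_singleton nat_diff_distrib)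
  then have "a - 1 < length (sorted_list_of_set ?S)"
    using assms(3) by auto
  from nth_mem[OF this] show ?thesis
    by (simp add: sigma_def)
qed

text \<open>Relative to the truncation through index \<open>m\<close>, only the digit at
  \<open>m\<close> is altered. This adds \<open>n * d * l ^ m\<close> with \<open>l\<close> not
  dividing \<open>n * d\<close>; everything else is a multiple of
  \<open>l ^ (m + 1)\<close>.\<close>

lemma multiplicity_branch:
  fixes l n a m t :: nat and \<gamma> :: int
  assumes "prime l" "coprime (int n) (int l)" "a \<in> {1..l - 1}"
  defines "\<delta> \<equiv> \<gamma> + int n * (U l n \<gamma> m a + int l ^ (m + 1) * int t)"
  shows "multiplicity (int l) \<delta> = m" "\<delta> \<noteq> 0"
proof -
  define d where "d = sigma l n \<gamma> m a - phi_digit l n \<gamma> m"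
  have l0: "l > 0"
    using assms(1) by (rule prime_gt_0_nat)
  obtain w where w: "\<gamma> + int n * phi_trunc l n \<gamma> (Suc m) = int l ^ Suc m * w"
    using dvd_add_phi_trunc[OF l0 assms(2)] by (meson dvdE)
  have "U l n \<gamma> m a = phi_trunc l n \<gamma> (Suc m) + d * int l ^ m"
    by (simp add: U_def phi_trunc_def d_def algebra_simps)
  then have "\<delta> = (\<gamma> + int n * phi_trunc l n \<gamma> (Suc m)) + int n * d * int l ^ m
      + int n * int l ^ Suc m * int t"
    by (simp add: \<delta>_def algebra_simps)
  also have "\<dots> = int l ^ m * (int n * d + int l * (w + int n * int t))"
    unfolding w by (simp add: algebra_simps)
  finally have \<delta>: "\<delta> = int l ^ m * (int n * d + int l * (w + int n * int t))" .
  \<comment> \<open>Two distinct digits in \<open>[0, l - 1]\<close> cannot be congruent modulo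
    \<open>l\<close>.\<close>
  have "d \<noteq> 0" "\<bar>d\<bar> < int l"
    using sigma_mem[OF l0 assms(2,3), of \<gamma> m]
      padic_digit_range[OF phi_carrier[OF l0 assms(2)], of \<gamma> m] by (auto simp: d_def)
  then have "\<not> int l dvd d"
    using dvd_imp_le_int[of d "int l"] by auto
  then have "\<not> int l dvd int n * d"
    using assms(2) by (simp add: coprime_dvd_mult_right_iff coprime_commute)
  then have nd: "\<not> int l dvd int n * d + int l * (w + int n * int t)"
    by (simp add: dvd_add_left_iff)
  show "multiplicity (int l) \<delta> = m"
    using nd l0 by (intro multiplicity_eqI) (simp_all add: \<delta> mult.commute[of "int l"])
  show "\<delta> \<noteq> 0"
    using nd l0 by (auto simp: \<delta>)
qed

theorem corollary5p1:
  fixes p e q l n \<tau> v :: nat and \<gamma> :: int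
  assumes "prime p" and "e \<ge> 1" and "q = p ^ e"
    and "prime l" and "odd l" and "l \<noteq> p"
    and "n > 0" and "\<not> p dvd n" and "\<not> l dvd n"
    and "\<tau> = card (cyc_coset q n \<gamma>)"
    and "int l dvd int q ^ \<tau> - 1"
    and "v = multiplicity (int l) (int q ^ \<tau> - 1)"
  shows "(\<forall>i. card (coset_seq_inf q l n \<gamma> i) = \<tau>) \<and>
    (\<forall>m. \<forall>a\<in>{1..l - 1}. \<forall>t\<in>{0..l ^ (v - 1) - 1}. \<forall>i.
       card (coset_seq q l n m a t \<gamma> i) =
         (if i \<le> m + v then \<tau> else l ^ (i - m - v) * \<tau>))"
proof -
  have q: "coprime q n" "coprime q l" "q > 1"
    using assms(1-4,6,8) prime_gt_1_nat[of p] one_less_power[of p e]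
    by (auto simp: prime_imp_coprime primes_coprime)
  have l: "l > 0" "coprime l n" "coprime (int n) (int l)"
    using assms(4,9) by (auto simp: prime_gt_0_nat prime_imp_coprime coprime_commute)
  have cong: "[\<gamma> + int n * x = \<gamma>] (mod int n)" for x
    by (simp add: cong_def)
  have "card (coset_seq_inf q l n \<gamma> i) = \<tau>" for i
    using card_cyc_coset_lift_dvd[OF q(1) l(2) q(2) assms(7) l(1) cong
        dvd_add_phi_trunc[OF l(1,3)]]
    by (simp add: coset_seq_inf_def assms(10))
  \<comment> \<open>The valuation of \<delta> is \<open>m\<close>. For \<open>i \<le> m + v\<close>
    the truncated exponent \<open>i - m - v\<close> is 0, so one formula yields both cases.\<close>
  moreover have "card (coset_seq q l n m a t \<gamma> i) =
      (if i \<le> m + v then \<tau> else l ^ (i - m - v) * \<tau>)" if "a \<in> {1..l - 1}" for m a t i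
    using card_cyc_coset_lift_multiplicity[OF q assms(4,5) l(2) assms(7) cong
        multiplicity_branch(2)[OF assms(4) l(3) that] assms(11)[unfolded assms(10)], of i m t]
      multiplicity_branch(1)[OF assms(4) l(3) that, of \<gamma> m t]
    by (simp add: coset_seq_def assms(10,12))
  ultimately show ?thesis
    by blast
qed

end
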